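(* Let $\sigma^{2},r\in(0,\infty)$ and $\theta\in\mathbb{R}$, and let $X\sim \mathrm{VGD}_{2}(\sigma^{2},r,\theta)$. Then for every $f\in\mathcal{S}(\mathbb{R})$, $$\mathbb{E}\left(\sigma^{2}Xf''(X)+\left(\sigma^{2}r+2\theta X\right)f'(X)+\left(r\theta-X\right)f(X)\right)=0.$$
   Context: $\mathcal{S}(\mathbb{R})$ is the Schwartz space on $\mathbb{R}$. For $\sigma^2,r\in(0,\infty)$ and $\theta\in\mathbb{R}$, a random variable $X$ has the variance-gamma distribution $\mathrm{VGD}_2(\sigma^2,r,\theta)$ if its characteristic function is $\mathbb{E}e^{izX}=\left(1-2i\theta z+\sigma^{2}z^{2}\right)^{-r/2}$, $z\in\mathbb{R}$ (principal branch of the power). *)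

theory Defs
  imports "HOL-Probability.Probability"
begin

definition vderiv :: "(real \<Rightarrow> complex) \<Rightarrow> real \<Rightarrow> complex" where
  "vderiv f x = vector_derivative f (at x)"

text \<open>The Schwartz space consists of complex-valued functions. The total operator
  \<^const>\<open>vector_derivative\<close> returns a junk value where no derivative exists, hence the
  explicit differentiability of every iterated derivative.\<close>

definition schwartz_space :: "(real \<Rightarrow> complex) set" where
  "schwartz_space = {f.
     (\<forall>k x. ((vderiv ^^ k) f) differentiable (at x)) \<and>
     (\<forall>m k. \<exists>C. \<forall>x. \<bar>x\<bar> ^ m * norm ((vderiv ^^ k) f x) \<le> C)}"

text \<open>The first parameter \<open>v\<close> is the squared parameter, written sigma squared. Complex
  \<open>powr\<close> is the principal branch; the base has real part at least 1 when \<open>v \<ge> 0\<close>.\<close>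

definition VGD2 :: "'a measure \<Rightarrow> ('a \<Rightarrow> real) \<Rightarrow> real \<Rightarrow> real \<Rightarrow> real \<Rightarrow> bool" where
  "VGD2 M X v r \<theta> \<longleftrightarrow> X \<in> borel_measurable M \<and>
     (\<forall>z::real. char (distr M borel X) z =
        (1 - 2 * \<i> * complex_of_real \<theta> * complex_of_real z
           + complex_of_real v * (complex_of_real z)\<^sup>2) powr complex_of_real (- r / 2))"

end

theory Submission
  imports Defs "HOL-Real_Asymp.Real_Asymp"
begin

text \<open>
  Let \<open>h\<close> be the function under the expectation, \<open>F\<close> and \<open>H\<close> the Fourier transforms of \<open>f\<close> and \<open>h\<close>,
  \<open>\<phi>\<close> the characteristic function of \<open>X\<close>, and \<open>q(z) = 1 - 2i\<theta>z + \<sigma>\<^sup>2z\<^sup>2\<close>.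
  Fourier inversion and Fubini turn the expectation of \<open>h(X)\<close> into \<open>(2\<pi>)\<^sup>-\<^sup>1 \<integral> \<phi> H\<close>.
  Since \<open>\<phi>\<close> is the power \<open>q\<^bsup>-r/2\<^esup>\<close>, the integrand \<open>\<phi> H\<close> equals \<open>-i (q \<phi> F)'\<close>,
  and \<open>q \<phi> F\<close> vanishes at infinity because \<open>|\<phi>| \<le> 1\<close> and \<open>F\<close> decays rapidly.
  All differentiation falls on \<open>q \<phi>\<close> and \<open>F\<close>, so that no moment of \<open>X\<close> is needed.
\<close>

section \<open>The Fourier transform on the real line\<close>

text \<open>Unnormalised, with the kernel \<open>exp(-izy)\<close>: the constant
  \<open>1 / (2 * pi)\<close> goes into the inversion formula, whose kernel \<open>exp(izx)\<close>
  is the one that \<open>char\<close> integrates.\<close>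

definition fourier :: "(real \<Rightarrow> complex) \<Rightarrow> real \<Rightarrow> complex" where
  "fourier f z = (CLINT y|lborel. iexp (- (z * y)) * f y)"

section \<open>Quadratic decay, integrability and integrals of derivatives\<close>

lemma integrable_inverse_1_plus_square_lborel:
  "integrable lborel (\<lambda>x::real. inverse (1 + x\<^sup>2))"
  using integrable_inverse_1_plus_square by (simp add: set_integrable_def)

lemma bounded_weights_imp_quadratic_decay:
  fixes f :: "real \<Rightarrow> complex"
  assumes "\<And>x. norm (f x) \<le> A" "\<And>x. \<bar>x\<bar> ^ 2 * norm (f x) \<le> B"
  shows "norm (f x) \<le> (A + B) * inverse (1 + x\<^sup>2)"
proof -
  have "norm (f x) * (1 + x\<^sup>2) \<le> A + B"
    using assms[of x] by (simp add: algebra_simps)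
  moreover have "1 + x\<^sup>2 > 0"
    by (simp add: add_pos_nonneg)
  ultimately show ?thesis
    by (simp add: field_simps)
qed

lemma quadratic_decay_integrable:
  fixes f :: "real \<Rightarrow> complex"
  assumes "f \<in> borel_measurable borel" "\<And>x. norm (f x) \<le> C * inverse (1 + x\<^sup>2)"
  shows "integrable lborel f"
proof (rule Bochner_Integration.integrable_bound)
  show "integrable lborel (\<lambda>x. C * inverse (1 + x\<^sup>2))"
    by (intro integrable_mult_right integrable_inverse_1_plus_square_lborel)
  show "AE x in lborel. norm (f x) \<le> norm (C * inverse (1 + x\<^sup>2))"
    using assms(2) by (intro AE_I2) (metis abs_ge_self order_trans real_norm_def)
qed (use assms in simp)

lemma quadratic_decay_tendsto_0:
  fixes f :: "real \<Rightarrow> complex"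
  assumes "\<And>x. norm (f x) \<le> C * inverse (1 + x\<^sup>2)"
  shows "(f \<longlongrightarrow> 0) at_top" "(f \<longlongrightarrow> 0) at_bot"
proof -
  have "((\<lambda>x::real. C * inverse (1 + x\<^sup>2)) \<longlongrightarrow> 0) at_top"
    by real_asymp
  then show "(f \<longlongrightarrow> 0) at_top"
    by (rule Lim_null_comparison[rotated]) (simp add: assms)
  have "((\<lambda>x::real. C * inverse (1 + x\<^sup>2)) \<longlongrightarrow> 0) at_bot"
    by real_asymp
  then show "(f \<longlongrightarrow> 0) at_bot"
    by (rule Lim_null_comparison[rotated]) (simp add: assms)
qed

text \<open>Fundamental theorem of calculus on the whole line with both boundary terms zero. It
  serves both the integration by parts for transforms and the final Stein identity.\<close>

lemma integral_derivative_eq_0: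
  fixes F f :: "real \<Rightarrow> complex"
  assumes "\<And>x. (F has_vector_derivative f x) (at x)" "\<And>x. isCont f x" "integrable lborel f"
    and "(F \<longlongrightarrow> 0) at_top" "(F \<longlongrightarrow> 0) at_bot"
  shows "(CLINT x|lborel. f x) = 0"
proof -
  have "(CLBINT x=-\<infinity>..\<infinity>. f x) = 0 - 0"
    using assms by (intro interval_integral_FTC_integrable[where F = F])
      (auto simp: ereal_tendsto_simps set_integrable_def)
  then show ?thesis
    by (simp add: interval_lebesgue_integral_def set_lebesgue_integral_def)
qed

section \<open>Linearity of the transform and its two differentiation rules\<close>

lemma integrable_fourier_integrand:
  fixes f :: "real \<Rightarrow> complex"
  assumes "integrable lborel f"
  shows "integrable lborel (\<lambda>y. iexp (- (z * y)) * f y)"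
  by (rule Bochner_Integration.integrable_bound[OF assms])
     (use assms in \<open>auto simp: norm_mult simp del: of_real_mult of_real_minus\<close>)

lemma norm_fourier_le: "norm (fourier f z) \<le> (LINT y|lborel. norm (f y))"
proof -
  have "norm (fourier f z) \<le> (LINT y|lborel. norm (iexp (- (z * y)) * f y))"
    unfolding fourier_def by (rule integral_norm_bound)
  then show ?thesis
    by (simp add: norm_mult del: of_real_mult of_real_minus)
qed

lemma fourier_add:
  "integrable lborel f \<Longrightarrow> integrable lborel g \<Longrightarrow>
    fourier (\<lambda>x. f x + g x) z = fourier f z + fourier g z"
  unfolding fourier_def distrib_left
  by (intro Bochner_Integration.integral_add integrable_fourier_integrand)

lemma fourier_cmult:
  "fourier (\<lambda>x. c * f x) z = c * fourier f z"
proof -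
  have "(\<lambda>y. iexp (- (z * y)) * (c * f y)) = (\<lambda>y. c * (iexp (- (z * y)) * f y))"
    by (simp add: ac_simps)
  then show ?thesis
    unfolding fourier_def by simp
qed

lemma has_vector_derivative_iexp_linear:
  "((\<lambda>y. iexp (- (z * y))) has_vector_derivative - (\<i> * z) * iexp (- (z * y))) (at y)"
proof -
  have "((\<lambda>w. exp (\<i> * (- (z * w)))) has_field_derivative - (\<i> * z) * exp (\<i> * (- (z * of_real y))))
      (at (complex_of_real y))"
    by (auto intro!: derivative_eq_intros)
  from has_vector_derivative_real_field[OF this] show ?thesis
    by simp
qed

text \<open>Integration by parts: the product of the exponential and \<open>f\<close> vanishes at
  both ends, so its derivative integrates to zero.\<close>

lemma fourier_derivative:
  fixes f f' :: "real \<Rightarrow> complex"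
  assumes d: "\<And>x. (f has_vector_derivative f' x) (at x)" and c: "\<And>x. isCont f' x"
    and i: "integrable lborel f" "integrable lborel f'"
    and l: "(f \<longlongrightarrow> 0) at_top" "(f \<longlongrightarrow> 0) at_bot"
  shows "fourier f' z = \<i> * z * fourier f z"
proof -
  let ?e = "\<lambda>y. iexp (- (z * y))"
  have cf: "isCont f x" for x
    using d has_vector_derivative_continuous by blast
  \<comment> \<open>The exponential has modulus one and does not affect convergence to zero.\<close>
  have *: "((\<lambda>y. ?e y * f y) \<longlongrightarrow> 0) G" if "(f \<longlongrightarrow> 0) G" for G
    by (rule tendsto_norm_zero_cancel)
       (use tendsto_norm_zero[OF that] in \<open>simp add: norm_mult del: of_real_mult of_real_minus\<close>)
  have "(CLINT y|lborel. ?e y * f' y + - (\<i> * z) * (?e y * f y)) = 0"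
  proof (rule integral_derivative_eq_0[where F = "\<lambda>y. ?e y * f y"])
    show "((\<lambda>y. ?e y * f y) has_vector_derivative ?e y * f' y + - (\<i> * z) * (?e y * f y)) (at y)" for y
      using has_vector_derivative_mult[OF has_vector_derivative_iexp_linear d]
      by (simp add: mult.assoc)
    show "isCont (\<lambda>y. ?e y * f' y + - (\<i> * z) * (?e y * f y)) y" for y
      by (intro continuous_intros c cf)
    show "integrable lborel (\<lambda>y. ?e y * f' y + - (\<i> * z) * (?e y * f y))"
      by (intro Bochner_Integration.integrable_add integrable_mult_right integrable_fourier_integrand i)
  qed (intro * l)+
  also have "(CLINT y|lborel. ?e y * f' y + - (\<i> * z) * (?e y * f y))
      = fourier f' z + - (\<i> * z) * fourier f z"
    unfolding fourier_def integral_mult_right_zero[symmetric]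
    by (intro Bochner_Integration.integral_add integrable_mult_right integrable_fourier_integrand i)
  finally show ?thesis
    by simp
qed

text \<open>Differentiation under the integral sign by a Taylor estimate: the remainder of the
  exponential is quadratic in \<open>(w - z) * y\<close>, and integrability of \<open>x^2 f\<close>
  turns it into an error of order \<open>(w - z)^2\<close>.\<close>

lemma has_vector_derivative_fourier:
  fixes f :: "real \<Rightarrow> complex"
  assumes i0: "integrable lborel f" and i1: "integrable lborel (\<lambda>x. x * f x)"
    and i2: "integrable lborel (\<lambda>x. (complex_of_real x)\<^sup>2 * f x)"
  shows "(fourier f has_vector_derivative - \<i> * fourier (\<lambda>x. x * f x) z) (at z)"
proof -
  define D where "D = - \<i> * fourier (\<lambda>x. x * f x) z"
  define K where "K = (LINT y|lborel. norm ((complex_of_real y)\<^sup>2 * f y)) / 2"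
  have i2': "integrable lborel (\<lambda>y. norm ((complex_of_real y)\<^sup>2 * f y) / 2)"
    using i2 by simp
  have bnd: "norm (fourier f w - fourier f z - (w - z) *\<^sub>R D) \<le> K * (w - z)\<^sup>2" for w
  proof -
    have eq: "fourier f w - fourier f z - (w - z) *\<^sub>R D =
       (CLINT y|lborel. iexp (- (w * y)) * f y - iexp (- (z * y)) * f y
          - (- \<i> * (w - z)) * (iexp (- (z * y)) * (y * f y)))"
    proof -
      have "(w - z) *\<^sub>R D = (- \<i> * (w - z)) * fourier (\<lambda>y. y * f y) z"
        unfolding D_def by (simp add: scaleR_conv_of_real)
      moreover have "(CLINT y|lborel. a y - b y - c y) =
          (CLINT y|lborel. a y) - (CLINT y|lborel. b y) - (CLINT y|lborel. c y)"
        if "integrable lborel a" "integrable lborel b" "integrable lborel c"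
        for a b c :: "real \<Rightarrow> complex"
        using that by simp
      ultimately show ?thesis
        unfolding fourier_def integral_mult_right_zero[symmetric]
        using integrable_fourier_integrand[OF i0]
          integrable_mult_right[OF integrable_fourier_integrand[OF i1]]
        by presburger
    qed
    have pw: "norm (iexp (- (w * y)) * f y - iexp (- (z * y)) * f y
          - (- \<i> * (w - z)) * (iexp (- (z * y)) * (y * f y)))
        \<le> (w - z)\<^sup>2 * (norm ((complex_of_real y)\<^sup>2 * f y) / 2)" for y
    proof -
      \<comment> \<open>Pulling out the unimodular factor at \<open>z\<close> leaves the first-order
        Taylor remainder of the exponential at \<open>-(w - z) * y\<close>.\<close>
      have "iexp (- (w * y)) = iexp (- (z * y)) * iexp (- ((w - z) * y))"
        by (simp add: exp_add[symmetric] algebra_simps)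
      then have "iexp (- (w * y)) * f y - iexp (- (z * y)) * f y
          - (- \<i> * (w - z)) * (iexp (- (z * y)) * (y * f y)) =
         iexp (- (z * y)) * ((iexp (- ((w - z) * y)) - (1 + \<i> * (- ((w - z) * y)))) * f y)"
        by (simp add: algebra_simps)
      also have "norm \<dots> = norm (iexp (- ((w - z) * y)) - (1 + \<i> * (- ((w - z) * y)))) * norm (f y)"
        by (simp add: norm_mult del: of_real_mult of_real_minus of_real_diff)
      also have "\<dots> \<le> ((w - z) * y)\<^sup>2 / 2 * norm (f y)"
        using iexp_approx1[of "- ((w - z) * y)" 1]
        by (intro mult_right_mono) (auto simp: numeral_2_eq_2 simp flip: power_abs)
      also have "\<dots> = (w - z)\<^sup>2 * (norm ((complex_of_real y)\<^sup>2 * f y) / 2)"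
        by (simp add: norm_mult power_mult_distrib norm_power)
      finally show ?thesis .
    qed
    have "norm (fourier f w - fourier f z - (w - z) *\<^sub>R D) \<le>
        (LINT y|lborel. (w - z)\<^sup>2 * (norm ((complex_of_real y)\<^sup>2 * f y) / 2))"
      unfolding eq using pw
      by (intro Bochner_Integration.integral_norm_bound_integral integrable_mult_right i2' Bochner_Integration.integrable_diff
          integrable_fourier_integrand i0 i1)
    also have "\<dots> = K * (w - z)\<^sup>2"
      unfolding K_def by simp
    finally show ?thesis .
  qed
  \<comment> \<open>Divided by the increment, the quadratic error is at most
    \<open>K * \<bar>w - z\<bar>\<close>.\<close>
  have "((\<lambda>w. (fourier f w - fourier f z - (w - z) *\<^sub>R D) /\<^sub>R norm (w - z)) \<longlongrightarrow> 0) (at z)"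
  proof (rule Lim_null_comparison)
    show "\<forall>\<^sub>F w in at z. norm ((fourier f w - fourier f z - (w - z) *\<^sub>R D) /\<^sub>R norm (w - z)) \<le> K * \<bar>w - z\<bar>"
      using bnd by (auto simp: eventually_at_filter divide_simps power2_eq_square mult.assoc
          simp flip: divide_inverse_commute intro!: always_eventually)
    show "((\<lambda>w. K * \<bar>w - z\<bar>) \<longlongrightarrow> 0) (at z)"
      by (auto intro!: tendsto_eq_intros)
  qed
  then show ?thesis
    unfolding has_vector_derivative_def has_derivative_at_within D_def[symmetric]
    by (auto simp: bounded_linear_scaleR_left)
qed

section \<open>Fourier inversion by Gaussian regularization\<close>

lemma integral_iexp_std_normal_density:
  "(CLINT n|lborel. std_normal_density n * iexp (t * n)) =
    complex_of_real (exp (- (t\<^sup>2) / 2))"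
proof -
  have "char std_normal_distribution t = (CLINT n|lborel. std_normal_density n * iexp (t * n))"
    unfolding char_def
    by (subst integral_density) (auto simp: scaleR_conv_of_real)
  then show ?thesis
    unfolding char_std_normal_distribution by (rule sym)
qed

text \<open>Both sides come from one double integral. Integrating out the Gaussian variable first
  smooths \<open>h\<close> at scale \<open>e\<close>; integrating out the argument of
  \<open>h\<close> first gives the inversion integral damped by a Gaussian. The damping makes the
  kernel absolutely integrable, so that Fubini applies.\<close>

lemma fourier_gaussian_regularization:
  fixes h :: "real \<Rightarrow> complex" and e x :: real
  assumes h: "integrable lborel h" and e: "e > 0"
  shows "(CLINT n|lborel. std_normal_density n * h (x + e * n)) =
    (CLINT z|lborel. std_normal_density (e * z) * (iexp (z * x) * fourier h z)) / sqrt (2 * pi)"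
proof -
  have hm [measurable]: "h \<in> borel_measurable borel"
    using h by auto
  \<comment> \<open>With \<open>z = n / e\<close> the phase is \<open>z * (x - y)\<close>, the
    product of the inversion kernel at \<open>x\<close> and the Fourier kernel at
    \<open>y\<close>.\<close>
  define k where "k y n = h y * (std_normal_density n * iexp ((x - y) / e * n))" for y n
  have ik: "integrable (lborel \<Otimes>\<^sub>M lborel) (case_prod k)"
  proof (rule lborel_pair.Fubini_integrable)
    have nk: "norm (k y n) = norm (h y) * std_normal_density n" for y n
      unfolding k_def by (simp add: norm_mult del: of_real_mult of_real_divide of_real_diff)
    show "case_prod k \<in> borel_measurable (lborel \<Otimes>\<^sub>M lborel)"
      unfolding k_def by measurable
    show "integrable lborel (\<lambda>y. LINT n|lborel. norm (case_prod k (y, n)))"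
      using h by (simp add: nk)
    show "AE y in lborel. integrable lborel (\<lambda>n. case_prod k (y, n))"
    proof (intro AE_I2)
      fix y
      have "integrable lborel (\<lambda>n. norm (h y) * std_normal_density n)"
        by simp
      then show "integrable lborel (\<lambda>n. case_prod k (y, n))"
        by (rule Bochner_Integration.integrable_bound) (auto simp: nk, simp add: k_def)
    qed
  qed
  have inner1: "(CLINT n|lborel. k y n) = sqrt (2 * pi) * (h y * std_normal_density ((y - x) / e))" for y
  proof -
    have "(CLINT n|lborel. k y n) = h y * complex_of_real (exp (- (((x - y) / e)\<^sup>2) / 2))"
      unfolding k_def integral_mult_right_zero integral_iexp_std_normal_density ..
    also have "exp (- (((x - y) / e)\<^sup>2) / 2) = sqrt (2 * pi) * std_normal_density ((y - x) / e)"
      by (simp add: std_normal_density_def power_divide power2_commute[of x y])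
    finally show ?thesis
      by simp
  qed
  have inner2: "(CLINT y|lborel. k y n) =
      std_normal_density n * (iexp ((n / e) * x) * fourier h (n / e))" for n
  proof -
    have "k y n = (std_normal_density n * iexp ((n / e) * x)) * (iexp (- ((n / e) * y)) * h y)" for y
    proof -
      have "iexp ((x - y) / e * n) = iexp ((n / e) * x) * iexp (- ((n / e) * y))"
        by (simp add: exp_add[symmetric] algebra_simps diff_divide_distrib)
      then show ?thesis
        unfolding k_def by (simp only: ac_simps)
    qed
    then show ?thesis
      unfolding fourier_def by (simp only: integral_mult_right_zero mult.assoc)
  qed
  have "(CLINT y|lborel. (CLINT n|lborel. k y n))
     = sqrt (2 * pi) * (CLINT y|lborel. h y * std_normal_density ((y - x) / e))"
    unfolding inner1 by simp
  \<comment> \<open>Substitution \<open>y = x + e * n\<close>, with Jacobian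
    \<open>e\<close>.\<close>
  also have "(CLINT y|lborel. h y * std_normal_density ((y - x) / e)) =
      e * (CLINT n|lborel. std_normal_density n * h (x + e * n))"
    using e by (subst lborel_integral_real_affine[of e _ x])
      (auto simp: scaleR_conv_of_real ac_simps)
  finally have 1: "(CLINT y|lborel. (CLINT n|lborel. k y n))
     = sqrt (2 * pi) * (e * (CLINT n|lborel. std_normal_density n * h (x + e * n)))" .
  \<comment> \<open>Substitution \<open>n = e * z\<close>; its Jacobian cancels the factor
    \<open>e\<close> of the other order of integration.\<close>
  have "(CLINT n|lborel. (CLINT y|lborel. k y n)) =
     e * (CLINT z|lborel. std_normal_density (e * z) * (iexp (z * x) * fourier h z))"
    unfolding inner2
    using e by (subst lborel_integral_real_affine[of e _ 0])
      (auto simp: scaleR_conv_of_real ac_simps)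
  moreover have "(CLINT n|lborel. (CLINT y|lborel. k y n)) = (CLINT y|lborel. (CLINT n|lborel. k y n))"
    by (rule lborel_pair.Fubini_integral[OF ik])
  ultimately show ?thesis
    using 1 e by (simp add: field_simps)
qed

text \<open>Let \<open>e\<close> tend to 0 in the regularized identity. Dominated convergence
  applies on the left since \<open>h\<close> is bounded and continuous, on the right since
  \<open>fourier h\<close> is integrable and the Gaussian density is at most 1.\<close>

theorem fourier_inversion:
  fixes h :: "real \<Rightarrow> complex"
  assumes h: "integrable lborel h" and H: "integrable lborel (fourier h)"
    and c: "\<And>x. isCont h x" and b: "\<And>x. norm (h x) \<le> C"
  shows "h x = (CLINT z|lborel. iexp (z * x) * fourier h z) / (2 * pi)"
proof -
  have hm [measurable]: "h \<in> borel_measurable borel" "fourier h \<in> borel_measurable borel"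
    using h H by auto
  let ?e = "\<lambda>k. inverse (real (Suc k))"
  have e: "?e \<longlonglongrightarrow> 0"
    by (rule LIMSEQ_inverse_real_of_nat)
  have 1: "(\<lambda>k. CLINT n|lborel. std_normal_density n * h (x + ?e k * n)) \<longlonglongrightarrow>
     (CLINT n|lborel. std_normal_density n * h (x + 0 * n))"
  proof (rule integral_dominated_convergence)
    show "integrable lborel (\<lambda>n. std_normal_density n * C)"
      by simp
    show "AE n in lborel. (\<lambda>k. std_normal_density n * h (x + ?e k * n)) \<longlonglongrightarrow>
        std_normal_density n * h (x + 0 * n)"
      by (intro AE_I2 tendsto_mult tendsto_const isCont_tendsto_compose[OF c] tendsto_add e)
    show "AE n in lborel. norm (std_normal_density n * h (x + ?e k * n)) \<le> std_normal_density n * C" for k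
      using b by (intro AE_I2) (auto simp: norm_mult intro!: mult_left_mono)
  qed auto
  have 2: "(\<lambda>k. CLINT z|lborel. std_normal_density (?e k * z) * (iexp (z * x) * fourier h z)) \<longlonglongrightarrow>
     (CLINT z|lborel. std_normal_density (0 * z) * (iexp (z * x) * fourier h z))"
  proof (rule integral_dominated_convergence)
    show "integrable lborel (\<lambda>z. norm (fourier h z))"
      using H by simp
    have cn: "isCont std_normal_density y" for y
      unfolding std_normal_density_def by (intro continuous_intros) auto
    show "AE z in lborel. (\<lambda>k. std_normal_density (?e k * z) * (iexp (z * x) * fourier h z)) \<longlonglongrightarrow>
        std_normal_density (0 * z) * (iexp (z * x) * fourier h z)"
      by (intro AE_I2 tendsto_mult tendsto_const tendsto_of_real isCont_tendsto_compose[OF cn] e)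
    have n1: "std_normal_density y \<le> 1" for y
    proof -
      have "1 \<le> sqrt (2 * pi)"
        using pi_gt3 by simp
      then have "1 / sqrt (2 * pi) * exp (- y\<^sup>2 / 2) \<le> 1 * 1"
        by (intro mult_mono) auto
      then show ?thesis
        unfolding std_normal_density_def by simp
    qed
    show "AE z in lborel. norm (std_normal_density (?e k * z) * (iexp (z * x) * fourier h z))
        \<le> norm (fourier h z)" for k
      using n1 by (intro AE_I2) (auto simp: norm_mult intro!: mult_left_le_one_le simp del: of_real_mult)
  qed auto
  have "(CLINT n|lborel. std_normal_density n * h (x + 0 * n)) =
      (CLINT z|lborel. std_normal_density (0 * z) * (iexp (z * x) * fourier h z)) / sqrt (2 * pi)"
    by (rule LIMSEQ_unique[OF 1])
       (subst fourier_gaussian_regularization[OF h], simp, intro tendsto_divide 2 tendsto_const, simp)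
  also have "(CLINT n|lborel. std_normal_density n * h (x + 0 * n)) = h x"
    by simp
  \<comment> \<open>The density at 0 supplies a second factor \<open>1 / sqrt (2 * pi)\<close>,
    which completes the constant \<open>1 / (2 * pi)\<close>.\<close>
  also have "(CLINT z|lborel. std_normal_density (0 * z) * (iexp (z * x) * fourier h z)) =
     (CLINT z|lborel. iexp (z * x) * fourier h z) / sqrt (2 * pi)"
    by (simp add: std_normal_density_def del: of_real_mult)
  also have "\<dots> / sqrt (2 * pi) =
     (CLINT z|lborel. iexp (z * x) * fourier h z) / complex_of_real (sqrt (2 * pi) * sqrt (2 * pi))"
    by (simp only: divide_divide_eq_left of_real_mult)
  also have "sqrt (2 * pi) * sqrt (2 * pi) = 2 * pi"
    by simp
  finally show ?thesis
    by simp
qed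

section \<open>Schwartz functions\<close>

text \<open>Avoids explicit formulas for iterated derivatives: if \<open>T\<close> is closed under
  \<open>vderiv\<close>, all iterates of \<open>f\<close> stay in \<open>T\<close>, and regularity
  and decay need checking only for undifferentiated members.\<close>

lemma schwartz_space_coinduct:
  assumes "f \<in> T" and "\<And>g. g \<in> T \<Longrightarrow> vderiv g \<in> T" and "\<And>g x. g \<in> T \<Longrightarrow> g differentiable (at x)"
    and "\<And>g m. g \<in> T \<Longrightarrow> \<exists>C. \<forall>x. \<bar>x\<bar> ^ m * norm (g x) \<le> C"
  shows "f \<in> schwartz_space"
proof -
  have "(vderiv ^^ k) f \<in> T" for k
    by (induction k) (auto simp: assms)
  then show ?thesis
    unfolding schwartz_space_def using assms by blast
qed

lemma schwartz_has_vector_derivative: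
  assumes "f \<in> schwartz_space"
  shows "(f has_vector_derivative vderiv f x) (at x)"
proof -
  have "((vderiv ^^ 0) f) differentiable (at x)"
    using assms unfolding schwartz_space_def by blast
  then show ?thesis
    by (simp add: vderiv_def vector_derivative_works[symmetric])
qed

lemma vderiv_eqI: "(\<And>x. (f has_vector_derivative f' x) (at x)) \<Longrightarrow> vderiv f = f'"
  unfolding vderiv_def by (auto intro: vector_derivative_at)

lemma schwartz_vderiv:
  assumes "f \<in> schwartz_space"
  shows "vderiv f \<in> schwartz_space"
proof -
  have "(vderiv ^^ k) (vderiv f) = (vderiv ^^ Suc k) f" for k
    by (simp add: funpow_swap1)
  then show ?thesis
    using assms unfolding schwartz_space_def by (simp del: funpow.simps)
qed

lemma schwartz_funpow_vderiv: "f \<in> schwartz_space \<Longrightarrow> (vderiv ^^ k) f \<in> schwartz_space"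
  by (induction k) (auto intro: schwartz_vderiv)

lemma schwartz_weighted_bound:
  assumes "f \<in> schwartz_space"
  obtains C where "\<And>x. \<bar>x\<bar> ^ m * norm (f x) \<le> C"
proof -
  have "\<exists>C. \<forall>x. \<bar>x\<bar> ^ m * norm ((vderiv ^^ 0) f x) \<le> C"
    using assms unfolding schwartz_space_def by blast
  then show ?thesis
    using that by auto
qed

lemma schwartz_lincomb:
  assumes "f \<in> schwartz_space" "g \<in> schwartz_space"
  shows "(\<lambda>x. c * f x + d * g x) \<in> schwartz_space"
proof (rule schwartz_space_coinduct)
  \<comment> \<open>Differentiation changes the two functions but keeps the coefficients, so this
    set is closed under \<open>vderiv\<close>.\<close>
  let ?T = "{\<lambda>x. c * f x + d * g x | f g. f \<in> schwartz_space \<and> g \<in> schwartz_space}"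
  show "(\<lambda>x. c * f x + d * g x) \<in> ?T"
    using assms by blast
  fix h
  assume "h \<in> ?T"
  then obtain f g where fg: "f \<in> schwartz_space" "g \<in> schwartz_space"
    and h: "h = (\<lambda>x. c * f x + d * g x)" by blast
  have d: "(h has_vector_derivative c * vderiv f x + d * vderiv g x) (at x)" for x
    unfolding h
    by (intro has_vector_derivative_add has_vector_derivative_mult_right
        schwartz_has_vector_derivative fg)
  then show "h differentiable (at x)" for x
    by (rule differentiableI_vector)
  have "vderiv h = (\<lambda>x. c * vderiv f x + d * vderiv g x)"
    by (rule vderiv_eqI[OF d])
  then show "vderiv h \<in> ?T"
    using schwartz_vderiv[OF fg(1)] schwartz_vderiv[OF fg(2)] by blast
  fix m
  obtain A where A: "\<And>x. \<bar>x\<bar> ^ m * norm (f x) \<le> A"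
    using schwartz_weighted_bound[OF fg(1)] by blast
  obtain B where B: "\<And>x. \<bar>x\<bar> ^ m * norm (g x) \<le> B"
    using schwartz_weighted_bound[OF fg(2)] by blast
  have "\<bar>x\<bar> ^ m * norm (h x) \<le> norm c * A + norm d * B" for x
  proof -
    have "\<bar>x\<bar> ^ m * norm (h x) \<le> \<bar>x\<bar> ^ m * (norm c * norm (f x) + norm d * norm (g x))"
      unfolding h by (intro mult_left_mono) (auto simp flip: norm_mult intro: norm_triangle_ineq)
    also have "\<dots> = norm c * (\<bar>x\<bar> ^ m * norm (f x)) + norm d * (\<bar>x\<bar> ^ m * norm (g x))"
      by (simp add: algebra_simps)
    also have "\<dots> \<le> norm c * A + norm d * B"
      by (intro add_mono mult_left_mono A B) auto
    finally show ?thesis .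
  qed
  then show "\<exists>C. \<forall>x. \<bar>x\<bar> ^ m * norm (h x) \<le> C"
    by blast
qed

lemma schwartz_add:
  "f \<in> schwartz_space \<Longrightarrow> g \<in> schwartz_space \<Longrightarrow> (\<lambda>x. f x + g x) \<in> schwartz_space"
  using schwartz_lincomb[of f g 1 1] by simp

lemma schwartz_cmult: "f \<in> schwartz_space \<Longrightarrow> (\<lambda>x. c * f x) \<in> schwartz_space"
  using schwartz_lincomb[of f f c 0] by simp

section \<open>Multiplication by the variable\<close>

lemma has_vector_derivative_ident_mult:
  assumes "f \<in> schwartz_space"
  shows "((\<lambda>x. complex_of_real x * f x) has_vector_derivative f x + x * vderiv f x) (at x)"
proof -
  have "(complex_of_real has_vector_derivative 1) (at x)"
    using has_vector_derivative_of_real[OF DERIV_ident] by simp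
  from has_vector_derivative_mult[OF this schwartz_has_vector_derivative[OF assms]]
  show ?thesis
    by (simp add: add.commute)
qed

lemma vderiv_ident_mult:
  "f \<in> schwartz_space \<Longrightarrow> vderiv (\<lambda>x. complex_of_real x * f x) = (\<lambda>x. f x + x * vderiv f x)"
  by (rule vderiv_eqI) (rule has_vector_derivative_ident_mult)

lemma schwartz_ident_mult:
  assumes "f \<in> schwartz_space"
  shows "(\<lambda>x. complex_of_real x * f x) \<in> schwartz_space"
proof (rule schwartz_space_coinduct)
  \<comment> \<open>Closed under differentiation, as \<open>(x f + g)' = x f' + (f + g')\<close>.\<close>
  let ?T = "{\<lambda>x. complex_of_real x * f x + g x | f g. f \<in> schwartz_space \<and> g \<in> schwartz_space}"
  \<comment> \<open>The zero function, as the summand \<open>g\<close> that places the initial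
    function in \<open>?T\<close>.\<close>
  have "(\<lambda>x. (0::complex) * f x) \<in> schwartz_space"
    by (rule schwartz_cmult[OF assms])
  then show "(\<lambda>x. complex_of_real x * f x) \<in> ?T"
    using assms by (intro CollectI exI[of _ f] exI[of _ "\<lambda>x. (0::complex) * f x"]) auto
  fix h
  assume "h \<in> ?T"
  then obtain f g where fg: "f \<in> schwartz_space" "g \<in> schwartz_space"
    and h: "h = (\<lambda>x. complex_of_real x * f x + g x)" by blast
  have d: "(h has_vector_derivative x * vderiv f x + (f x + vderiv g x)) (at x)" for x
    unfolding h
    using has_vector_derivative_add[OF has_vector_derivative_ident_mult[OF fg(1)]
        schwartz_has_vector_derivative[OF fg(2)]]
    by (simp add: ac_simps)
  then show "h differentiable (at x)" for x
    by (rule differentiableI_vector)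
  have "vderiv h = (\<lambda>x. complex_of_real x * vderiv f x + (f x + vderiv g x))"
    by (rule vderiv_eqI[OF d])
  moreover have "(\<lambda>x. f x + vderiv g x) \<in> schwartz_space"
    by (intro schwartz_add schwartz_vderiv fg)
  ultimately show "vderiv h \<in> ?T"
    using schwartz_vderiv[OF fg(1)]
    by (intro CollectI exI[of _ "vderiv f"] exI[of _ "\<lambda>x. f x + vderiv g x"]) auto
  fix m
  \<comment> \<open>The factor \<open>x\<close> in front of \<open>f\<close> consumes one additional
    power of the weight.\<close>
  obtain A where A: "\<And>x. \<bar>x\<bar> ^ Suc m * norm (f x) \<le> A"
    using schwartz_weighted_bound[OF fg(1)] by blast
  obtain B where B: "\<And>x. \<bar>x\<bar> ^ m * norm (g x) \<le> B"
    using schwartz_weighted_bound[OF fg(2)] by blast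
  have "\<bar>x\<bar> ^ m * norm (h x) \<le> A + B" for x
  proof -
    have "\<bar>x\<bar> ^ m * norm (h x) \<le> \<bar>x\<bar> ^ m * (norm (x * f x) + norm (g x))"
      unfolding h by (intro mult_left_mono norm_triangle_ineq) auto
    also have "\<dots> = \<bar>x\<bar> ^ Suc m * norm (f x) + \<bar>x\<bar> ^ m * norm (g x)"
      by (simp add: algebra_simps norm_mult)
    also have "\<dots> \<le> A + B"
      by (intro add_mono A B)
    finally show ?thesis .
  qed
  then show "\<exists>C. \<forall>x. \<bar>x\<bar> ^ m * norm (h x) \<le> C"
    by blast
qed

section \<open>Continuity, integrability and limits of Schwartz functions\<close>

lemma schwartz_isCont: "f \<in> schwartz_space \<Longrightarrow> isCont f x"
  using schwartz_has_vector_derivative has_vector_derivative_continuous by blast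

lemma schwartz_borel_measurable: "f \<in> schwartz_space \<Longrightarrow> f \<in> borel_measurable borel"
  by (intro borel_measurable_continuous_onI continuous_at_imp_continuous_on ballI schwartz_isCont)

lemma schwartz_quadratic_decay:
  assumes "f \<in> schwartz_space"
  obtains C where "\<And>x. norm (f x) \<le> C * inverse (1 + x\<^sup>2)"
proof -
  obtain A where "\<And>x. \<bar>x\<bar> ^ 0 * norm (f x) \<le> A"
    using schwartz_weighted_bound[OF assms] by blast
  moreover obtain B where "\<And>x. \<bar>x\<bar> ^ 2 * norm (f x) \<le> B"
    using schwartz_weighted_bound[OF assms] by blast
  ultimately have "norm (f x) \<le> (A + B) * inverse (1 + x\<^sup>2)" for x
    by (intro bounded_weights_imp_quadratic_decay) auto
  then show ?thesis
    by (rule that)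
qed

lemma schwartz_integrable:
  assumes "f \<in> schwartz_space"
  shows "integrable lborel f"
proof -
  obtain C where "\<And>x. norm (f x) \<le> C * inverse (1 + x\<^sup>2)"
    using schwartz_quadratic_decay[OF assms] by blast
  then show ?thesis
    by (rule quadratic_decay_integrable[OF schwartz_borel_measurable[OF assms]])
qed

lemma schwartz_tendsto_0:
  assumes "f \<in> schwartz_space"
  shows "(f \<longlongrightarrow> 0) at_top" "(f \<longlongrightarrow> 0) at_bot"
proof -
  obtain C where "\<And>x. norm (f x) \<le> C * inverse (1 + x\<^sup>2)"
    using schwartz_quadratic_decay[OF assms] by blast
  then show "(f \<longlongrightarrow> 0) at_top" "(f \<longlongrightarrow> 0) at_bot"
    by (rule quadratic_decay_tendsto_0)+
qed

section \<open>Fourier transforms of Schwartz functions\<close>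

lemma fourier_vderiv:
  assumes "f \<in> schwartz_space"
  shows "fourier (vderiv f) z = \<i> * z * fourier f z"
  using assms
  by (intro fourier_derivative schwartz_has_vector_derivative schwartz_isCont schwartz_integrable
      schwartz_vderiv schwartz_tendsto_0)

text \<open>Transform the product rule \<open>(x f)' = f + x f'\<close> and solve for the last
  term.\<close>

lemma fourier_ident_mult_vderiv:
  assumes f: "f \<in> schwartz_space"
  shows "fourier (\<lambda>x. complex_of_real x * vderiv f x) z = \<i> * z * fourier (\<lambda>x. complex_of_real x * f x) z - fourier f z"
proof -
  have "fourier (vderiv (\<lambda>x. complex_of_real x * f x)) z = fourier f z + fourier (\<lambda>x. complex_of_real x * vderiv f x) z"
    unfolding vderiv_ident_mult[OF f]
    by (intro fourier_add schwartz_integrable schwartz_ident_mult schwartz_vderiv f)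
  then show ?thesis
    using fourier_vderiv[OF schwartz_ident_mult[OF f]] by simp
qed

lemma schwartz_fourier_has_vector_derivative:
  assumes f: "f \<in> schwartz_space"
  shows "(fourier f has_vector_derivative - \<i> * fourier (\<lambda>x. complex_of_real x * f x) z) (at z)"
proof (rule has_vector_derivative_fourier)
  have "integrable lborel (\<lambda>x. complex_of_real x * (x * f x))"
    by (intro schwartz_integrable schwartz_ident_mult f)
  then show "integrable lborel (\<lambda>x. (complex_of_real x)\<^sup>2 * f x)"
    by (simp add: power2_eq_square mult.assoc)
qed (intro schwartz_integrable schwartz_ident_mult f)+

lemma schwartz_fourier_isCont: "f \<in> schwartz_space \<Longrightarrow> isCont (fourier f) z"
  using schwartz_fourier_has_vector_derivative has_vector_derivative_continuous by blast

text \<open>Smoothness becomes decay: the weighted modulus is that of the transform of the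
  \<open>m\<close>-th derivative, which is bounded by the L1 norm of that derivative.\<close>

lemma schwartz_fourier_weighted_bound:
  assumes f: "f \<in> schwartz_space"
  obtains C where "\<And>z. \<bar>z\<bar> ^ m * norm (fourier f z) \<le> C"
proof
  fix z
  have "fourier ((vderiv ^^ m) f) z = (\<i> * z) ^ m * fourier f z"
    by (induction m) (auto simp: fourier_vderiv schwartz_funpow_vderiv f)
  then have "\<bar>z\<bar> ^ m * norm (fourier f z) = norm (fourier ((vderiv ^^ m) f) z)"
    by (simp add: norm_mult norm_power)
  also have "\<dots> \<le> (LINT y|lborel. norm ((vderiv ^^ m) f y))"
    by (rule norm_fourier_le)
  finally show "\<bar>z\<bar> ^ m * norm (fourier f z) \<le> (LINT y|lborel. norm ((vderiv ^^ m) f y))" .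
qed

lemma schwartz_fourier_integrable:
  assumes f: "f \<in> schwartz_space"
  shows "integrable lborel (fourier f)"
proof -
  obtain A where A: "\<And>x. \<bar>x\<bar> ^ 0 * norm (fourier f x) \<le> A"
    using schwartz_fourier_weighted_bound[OF f] by blast
  obtain B where B: "\<And>x. \<bar>x\<bar> ^ 2 * norm (fourier f x) \<le> B"
    using schwartz_fourier_weighted_bound[OF f] by blast
  show ?thesis
  proof (rule quadratic_decay_integrable)
    show "norm (fourier f x) \<le> (A + B) * inverse (1 + x\<^sup>2)" for x
      by (rule bounded_weights_imp_quadratic_decay) (use A B in auto)
    show "fourier f \<in> borel_measurable borel"
      by (intro borel_measurable_continuous_onI continuous_at_imp_continuous_on ballI
          schwartz_fourier_isCont f)
  qed
qed

lemma schwartz_bounded: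
  assumes "f \<in> schwartz_space"
  obtains C where "\<And>x. norm (f x) \<le> C"
  using schwartz_weighted_bound[OF assms, of 0] by auto

section \<open>Characteristic functions and the Stein identity\<close>

text \<open>Insert the inversion formula for \<open>h x\<close> and exchange the integrals;
  integrating the exponential over \<open>M\<close> gives \<open>char M z\<close>. Fubini applies
  because the modulus of the integrand does not depend on \<open>x\<close> and \<open>M\<close> has
  mass one.\<close>

theorem (in real_distribution) expectation_schwartz_eq_char_fourier:
  assumes h: "h \<in> schwartz_space"
  shows "(CLINT x|M. h x) = (CLINT z|lborel. char M z * fourier h z) / (2 * pi)"
proof -
  interpret P: pair_sigma_finite lborel M ..
  have H: "integrable lborel (fourier h)"
    by (rule schwartz_fourier_integrable[OF h])
  then have [measurable]: "fourier h \<in> borel_measurable borel"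
    by auto
  obtain C where C: "\<And>x. norm (h x) \<le> C"
    using schwartz_bounded[OF h] by blast
  have inv: "h x = (CLINT z|lborel. iexp (z * x) * fourier h z) / (2 * pi)" for x
    by (rule fourier_inversion[OF schwartz_integrable[OF h] H schwartz_isCont[OF h] C])
  define k where "k z x = iexp (z * x) * fourier h z" for z x
  have nk: "norm (k z x) = norm (fourier h z)" for z x
    unfolding k_def by (simp add: norm_mult del: of_real_mult)
  have km: "case_prod k \<in> borel_measurable (lborel \<Otimes>\<^sub>M M)"
    unfolding k_def by measurable
  have "integrable (lborel \<Otimes>\<^sub>M M) (case_prod k)"
  proof (rule P.Fubini_integrable[OF km])
    show "integrable lborel (\<lambda>z. LINT x|M. norm (case_prod k (z, x)))"
      using H by (simp add: nk prob_space)
    show "AE z in lborel. integrable M (\<lambda>x. case_prod k (z, x))"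
    proof (intro AE_I2)
      fix z
      show "integrable M (\<lambda>x. case_prod k (z, x))"
        by (rule integrable_const_bound[where B = "norm (fourier h z)"])
           (auto simp: nk, simp add: k_def)
    qed
  qed
  then have "(CLINT x|M. CLINT z|lborel. k z x) = (CLINT z|lborel. CLINT x|M. k z x)"
    by (rule P.Fubini_integral)
  also have "(\<lambda>x. CLINT z|lborel. k z x) = (\<lambda>x. 2 * pi * h x)"
    unfolding k_def by (subst inv) simp
  also have "(\<lambda>z. CLINT x|M. k z x) = (\<lambda>z. char M z * fourier h z)"
    unfolding k_def char_def by (simp only: integral_mult_left_zero)
  finally show ?thesis
    by (simp add: field_simps)
qed

text \<open>This is the derivative of the power with exponent \<open>1 + a\<close>. Keeping it as a
  product leaves \<open>q z powr a\<close> visible, later the characteristic function. Off the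
  closed negative axis the principal branch is differentiable.\<close>

lemma has_vector_derivative_mult_powr_self:
  fixes q :: "real \<Rightarrow> complex"
  assumes "(q has_vector_derivative q') (at z)" and "q z \<notin> \<real>\<^sub>\<le>\<^sub>0"
  shows "((\<lambda>z. q z * q z powr a) has_vector_derivative (1 + a) * q z powr a * q') (at z)"
proof -
  have nz: "q z \<noteq> 0"
    using assms(2) by auto
  have "((\<lambda>w. w * w powr a) has_field_derivative 1 * q z powr a + a * q z powr (a - 1) * q z) (at (q z))"
    by (rule DERIV_mult[OF DERIV_ident has_field_derivative_powr[OF assms(2)]])
  moreover have "1 * q z powr a + a * q z powr (a - 1) * q z = (1 + a) * q z powr a"
    using nz by (simp add: powr_diff distrib_right)
  ultimately have "((\<lambda>w. w * w powr a) has_field_derivative (1 + a) * q z powr a) (at (q z))"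
    by simp
  from field_vector_diff_chain_at[OF assms(1) this] show ?thesis
    by (simp add: o_def mult.commute)
qed

text \<open>Condition \<open>H\<close> makes \<open>\<i> * char M z * fourier h z\<close> the exact
  derivative of \<open>\<Psi>\<close>, which vanishes at both ends.\<close>

lemma (in real_distribution) integral_char_fourier_stein_eq_0:
  fixes v r \<theta> :: real and f h :: "real \<Rightarrow> complex"
  defines "q \<equiv> \<lambda>z::real. 1 - 2 * \<i> * complex_of_real \<theta> * complex_of_real z
      + complex_of_real v * (complex_of_real z)\<^sup>2"
  assumes v: "0 < v" and f: "f \<in> schwartz_space"
    and \<phi>: "\<And>z. char M z = q z powr complex_of_real (- r / 2)"
    and h: "h \<in> schwartz_space"
    and H: "\<And>z. fourier h z = - q z * fourier (\<lambda>x. complex_of_real x * f x) z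
      + (r - 2) * (\<i> * v * z + \<theta>) * fourier f z"
  shows "(CLINT z|lborel. char M z * fourier h z) = 0"
proof -
  define \<Psi> where "\<Psi> z = q z * q z powr complex_of_real (- r / 2) * fourier f z" for z
  have q': "(q has_vector_derivative 2 * v * z - 2 * \<i> * \<theta>) (at z)" for z
  proof -
    have "((\<lambda>w. 1 - 2 * \<i> * complex_of_real \<theta> * w + complex_of_real v * w\<^sup>2)
        has_field_derivative 2 * v * z - 2 * \<i> * \<theta>) (at (complex_of_real z))"
      by (auto intro!: derivative_eq_intros)
    from has_vector_derivative_real_field[OF this] show ?thesis
      unfolding q_def by simp
  qed
  \<comment> \<open>The real part is \<open>1 + v * z^2\<close>, so \<open>q\<close> stays away from
    the branch cut.\<close>
  have "Re (q z) > 0" for z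
    using v by (simp add: q_def add_pos_nonneg flip: of_real_power)
  then have qn: "q z \<notin> \<real>\<^sub>\<le>\<^sub>0" for z
    by (metis complex_nonpos_Reals_iff not_le)
  have \<Psi>': "(\<Psi> has_vector_derivative \<i> * (char M z * fourier h z)) (at z)" for z
  proof -
    have "(\<Psi> has_vector_derivative
        q z * q z powr complex_of_real (- r / 2) * (- \<i> * fourier (\<lambda>x. complex_of_real x * f x) z) +
        (1 + complex_of_real (- r / 2)) * q z powr complex_of_real (- r / 2) *
          (2 * v * z - 2 * \<i> * \<theta>) * fourier f z) (at z)"
      unfolding \<Psi>_def
      by (intro has_vector_derivative_mult has_vector_derivative_mult_powr_self q' qn
          schwartz_fourier_has_vector_derivative f)
    \<comment> \<open>The coefficients of \<open>fourier f z\<close> agree: \<open>(1 - r/2) * (2 *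
      v * z - 2 * \<i> * \<theta>) = \<i> * (r - 2) * (\<i> * v * z + \<theta>)\<close>.\<close>
    also have "q z * q z powr complex_of_real (- r / 2) * (- \<i> * fourier (\<lambda>x. complex_of_real x * f x) z) +
        (1 + complex_of_real (- r / 2)) * q z powr complex_of_real (- r / 2) *
          (2 * v * z - 2 * \<i> * \<theta>) * fourier f z = \<i> * (char M z * fourier h z)"
      unfolding H \<phi> by (simp add: field_simps)
    finally show ?thesis .
  qed
  \<comment> \<open>Since \<open>q\<close> grows quadratically, \<open>fourier f\<close> must decay
    like \<open>(1 + z^2)^(-2)\<close>. Expanding \<open>(1 + z^2)^2 = 1 + 2 z^2 + z^4\<close> calls
    for the weights 0, 2 and 4 and yields the constant \<open>A + 2 * B + C\<close>.\<close>
  obtain A where A: "\<And>z. \<bar>z\<bar> ^ 0 * norm (fourier f z) \<le> A"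
    using schwartz_fourier_weighted_bound[OF f] by blast
  obtain B where B: "\<And>z. \<bar>z\<bar> ^ 2 * norm (fourier f z) \<le> B"
    using schwartz_fourier_weighted_bound[OF f] by blast
  obtain C where C: "\<And>z. \<bar>z\<bar> ^ 4 * norm (fourier f z) \<le> C"
    using schwartz_fourier_weighted_bound[OF f] by blast
  have \<Psi>_bound: "norm (\<Psi> z) \<le> (1 + \<bar>\<theta>\<bar> + v) * (A + 2 * B + C) * inverse (1 + z\<^sup>2)" for z
  proof -
    have p: "1 + z\<^sup>2 > 0"
      by (simp add: add_pos_nonneg)
    have "norm (q z) \<le> 1 + 2 * \<bar>\<theta>\<bar> * \<bar>z\<bar> + v * z\<^sup>2"
    proof -
      have "norm (q z) \<le> norm (1 - 2 * \<i> * complex_of_real \<theta> * complex_of_real z)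
          + norm (complex_of_real v * (complex_of_real z)\<^sup>2)"
        unfolding q_def by (rule norm_triangle_ineq)
      also have "\<dots> \<le> (1 + 2 * \<bar>\<theta>\<bar> * \<bar>z\<bar>) + v * z\<^sup>2"
        using v norm_triangle_ineq4[of 1 "2 * \<i> * complex_of_real \<theta> * complex_of_real z"]
        by (intro add_mono) (auto simp: norm_mult norm_power)
      finally show ?thesis .
    qed
    also have "\<dots> \<le> (1 + \<bar>\<theta>\<bar> + v) * (1 + z\<^sup>2)"
    proof -
      have "2 * \<bar>z\<bar> \<le> 1 + z\<^sup>2"
        using sum_squares_bound[of 1 "\<bar>z\<bar>"] by simp
      then have "\<bar>\<theta>\<bar> * (2 * \<bar>z\<bar>) \<le> \<bar>\<theta>\<bar> * (1 + z\<^sup>2)"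
        by (intro mult_left_mono) auto
      moreover have "0 \<le> z\<^sup>2"
        by simp
      ultimately show ?thesis
        using v unfolding distrib_left distrib_right mult_1_left mult_1_right by linarith
    qed
    finally have qb: "norm (q z) \<le> (1 + \<bar>\<theta>\<bar> + v) * (1 + z\<^sup>2)" .
    have "norm (fourier f z) * (1 + z\<^sup>2)\<^sup>2 \<le> A + 2 * B + C"
      using A[of z] B[of z] C[of z] by (simp add: power2_sum algebra_simps)
    then have Fb: "norm (fourier f z) \<le> (A + 2 * B + C) / (1 + z\<^sup>2)\<^sup>2"
      using p by (simp add: field_simps)
    \<comment> \<open>Reading the power as \<open>char M z\<close> bounds its modulus by 1.\<close>
    have "norm (\<Psi> z) = norm (q z) * norm (char M z) * norm (fourier f z)"
      unfolding \<Psi>_def \<phi> by (simp add: norm_mult)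
    also have "\<dots> \<le> ((1 + \<bar>\<theta>\<bar> + v) * (1 + z\<^sup>2)) * 1 * ((A + 2 * B + C) / (1 + z\<^sup>2)\<^sup>2)"
      using v p by (intro mult_mono qb Fb cmod_char_le_1) auto
    also have "\<dots> = (1 + \<bar>\<theta>\<bar> + v) * (A + 2 * B + C) * inverse (1 + z\<^sup>2)"
      using p by (simp add: power2_eq_square divide_simps)
    finally show ?thesis .
  qed
  have "(CLINT z|lborel. \<i> * (char M z * fourier h z)) = 0"
  proof (rule integral_derivative_eq_0[OF \<Psi>'])
    show "isCont (\<lambda>z. \<i> * (char M z * fourier h z)) z" for z
      by (intro continuous_intros isCont_char schwartz_fourier_isCont h)
    have "integrable lborel (\<lambda>z. char M z * fourier h z)"
    proof (rule Bochner_Integration.integrable_bound[OF schwartz_fourier_integrable[OF h]])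
      show "AE z in lborel. norm (char M z * fourier h z) \<le> norm (fourier h z)"
        by (intro AE_I2) (simp add: norm_mult mult_left_le_one_le cmod_char_le_1)
      show "(\<lambda>z. char M z * fourier h z) \<in> borel_measurable lborel"
        using borel_measurable_integrable[OF schwartz_fourier_integrable[OF h]] char_measurable
        by simp
    qed
    then show "integrable lborel (\<lambda>z. \<i> * (char M z * fourier h z))"
      by (rule integrable_mult_right)
  qed (rule quadratic_decay_tendsto_0[OF \<Psi>_bound])+
  then show ?thesis
    by simp
qed

text \<open>Integrability is claimed separately because the Bochner integral of a non-integrable
  function is 0 by default. It holds because \<open>Y\<close> is a bounded function of
  \<open>X\<close>.\<close>

theorem corollary3p3:
  fixes M :: "'a measure" and X :: "'a \<Rightarrow> real" and \<sigma> r \<theta> :: real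
    and f :: "real \<Rightarrow> complex"
  assumes "prob_space M"
    and "0 < \<sigma>\<^sup>2" and "0 < r"
    and "VGD2 M X (\<sigma>\<^sup>2) r \<theta>"
    and "f \<in> schwartz_space"
  defines "Y \<equiv> \<lambda>\<omega>. complex_of_real (\<sigma>\<^sup>2 * X \<omega>) * vderiv (vderiv f) (X \<omega>)
      + complex_of_real (\<sigma>\<^sup>2 * r + 2 * \<theta> * X \<omega>) * vderiv f (X \<omega>)
      + complex_of_real (r * \<theta> - X \<omega>) * f (X \<omega>)"
  shows "integrable M Y \<and> prob_space.expectation M Y = 0"
proof -
  define v where "v = \<sigma>\<^sup>2"
  have v: "0 < v"
    using assms(2) by (simp add: v_def)
  note f = assms(5)
  interpret prob_space M by fact
  have X [measurable]: "X \<in> borel_measurable M"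
    using assms(4) unfolding VGD2_def by blast
  interpret D: real_distribution "distr M borel X"
    by (rule real_distribution_distr[OF X])
  let ?c = complex_of_real
  \<comment> \<open>The integrand as a sum of constant multiples, each polynomial coefficient split
    up, so that closure of the Schwartz space and linearity of the transform apply term by
    term.\<close>
  define h where "h x = ?c v * (x * vderiv (vderiv f) x) + (?c (v * r) * vderiv f x
      + (?c (2 * \<theta>) * (x * vderiv f x) + (?c (r * \<theta>) * f x + (- 1) * (x * f x))))" for x
  note S = schwartz_add schwartz_cmult schwartz_ident_mult schwartz_vderiv
  have h: "h \<in> schwartz_space"
    unfolding h_def by (intro S f)
  have Y: "Y = (\<lambda>\<omega>. h (X \<omega>))"
    unfolding Y_def h_def v_def[symmetric] by (simp add: algebra_simps)
  \<comment> \<open>The term with \<open>x f''\<close> contributes \<open>-v z^2\<close> to the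
    coefficient of the transform of \<open>x f\<close> and \<open>-2 \<i> v z\<close> to that of
    \<open>fourier f z\<close>; the term with \<open>x f'\<close> contributes
    \<open>2 \<i> \<theta> z\<close> and \<open>-2 \<theta>\<close>. These shifts turn
    \<open>r\<close> into \<open>r - 2\<close>.\<close>
  have H: "fourier h z = - (1 - 2 * \<i> * ?c \<theta> * ?c z + ?c v * (?c z)\<^sup>2) * fourier (\<lambda>x. complex_of_real x * f x) z
      + (r - 2) * (\<i> * v * z + \<theta>) * fourier f z" for z
  proof -
    have "fourier h z = ?c v * fourier (\<lambda>x. complex_of_real x * vderiv (vderiv f) x) z + (?c (v * r) * fourier (vderiv f) z
      + (?c (2 * \<theta>) * fourier (\<lambda>x. complex_of_real x * vderiv f x) z
      + (?c (r * \<theta>) * fourier f z + (- 1) * fourier (\<lambda>x. complex_of_real x * f x) z)))"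
      unfolding h_def
      by (subst fourier_add, (intro schwartz_integrable S f)+)+ (simp only: fourier_cmult)
    then show ?thesis
      by (simp add: fourier_ident_mult_vderiv fourier_vderiv schwartz_vderiv f algebra_simps
          power2_eq_square)
  qed
  obtain C where C: "\<And>x. norm (h x) \<le> C"
    using schwartz_bounded[OF h] by blast
  have [measurable]: "h \<in> borel_measurable borel"
    by (rule schwartz_borel_measurable[OF h])
  have "integrable M Y"
    unfolding Y using C by (intro integrable_const_bound[where B = C]) auto
  moreover have "expectation Y = 0"
  proof -
    have "expectation Y = (CLINT x|distr M borel X. h x)"
      unfolding Y by (subst integral_distr) auto
    also have "\<dots> = (CLINT z|lborel. char (distr M borel X) z * fourier h z) / (2 * pi)"
      by (rule D.expectation_schwartz_eq_char_fourier[OF h])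
    also have "(CLINT z|lborel. char (distr M borel X) z * fourier h z) = 0"
      using assms(4) unfolding VGD2_def
      by (intro D.integral_char_fourier_stein_eq_0[OF v f _ h H]) (auto simp: v_def)
    finally show ?thesis
      by simp
  qed
  ultimately show ?thesis ..
qed

end
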